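(* Let $\alpha\ge1$, $m\ge2$, $b\geq 1$ and $2\le k<v$, where $v=\alpha m$ and $bk/v$ is an integer. Let $K_{\alpha,\dots,\alpha}$ be the regular complete $m$-partite graph with parts of size $\alpha$, with Laplacian matrix $L(K_{\alpha,\dots,\alpha})$. There exists an $x_0>0$ such that, for $x\ge x_0$, if there exists a design with Laplacian matrix $L[x]$ where $L=L(K_{\alpha,\dots,\alpha})\in\mathcal{L}_2(\alpha m,b,k)$, then it is $A$- and $D$-optimal among all designs with Laplacian matrix $L'[x]$ with $L'\in\mathcal{L}_2(\alpha m,b,k)$; that is, the $A$-value and the $D$-value of $L[x]$ are at least those of $L'[x]$ for every such $L'$ for which a design with Laplacian matrix $L'[x]$ exists.
   Context: A (binary block) design with $v$ treatments and $b$ blocks of size $k$ ($k<v$) is a list of $b$ (not necessarily distinct) $k$-element subsets (blocks) of a $v$-element set of treatments; it need not be connected. If $r_i$ is the number of blocks containing treatment $i$ and $N$ is the $v\times b$ treatment-block incidence matrix, its Laplacian matrix is $k\,\mathrm{diag}(r_1,\dots,r_v)-NN^T$. The non-trivial eigenvalues $\rho^L=(\rho^L_1,\dots,\rho^L_{v-1})$ of a Laplacian matrix $L$ are its eigenvalues (with multiplicity) other than one copy of the eigenvalue $0$ belonging to the all-ones vector. The Laplacian matrix of a graph is the diagonal matrix of vertex degrees minus the adjacency matrix. $K_{\alpha,\dots,\alpha}$ is the graph whose vertex set is partitioned into $m$ groups of size $\alpha$, two vertices being joined by an edge if and only if they are in different groups. $\mathcal{L}(v,b,k)$ is the set of Laplacian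 matrices of binary block designs with $v$ treatments and $b$ blocks of size $k$. $S_j$ is the $j$th elementary symmetric polynomial in $v-1$ variables. $\mathcal{L}_2(v,b,k)$ is the set of $L\in\mathcal{L}(v,b,k)$ with $S_j(\rho^L)=\max\{S_j(\rho^{L'}):L'\in\mathcal{L}(v,b,k)\}$ for $j=1,2$. A regular graph design (RGD) is a binary design in which every treatment occurs in the same number $r$ of blocks and any two distinct treatments occur together in either $\lambda$ or $\lambda+1$ blocks for some integer $\lambda\ge0$. When RGDs with parameters $v,b,k$ exist, $\mathcal{L}_2(v,b,k)$ is exactly the set of Laplacian matrices of RGDs. With $r=bk/v$, $\lambda=\lfloor r(k-1)/(v-1)\rfloor$ and $\delta=r(k-1)-\lambda(v-1)$, each such $L\in\mathcal{L}_2(v,b,k)$ can be written uniquely as $L=(\delta+v\lambda)I_v-T-\lambda J_v$, where $T$ is the adjacency matrix of a simple $\delta$-regular graph on $v$ vertices ($I_v$ identity, $J_v$ all-ones matrix). For such $L$ and $x\geq\lambda$, $L[x]=(\delta+vx)I_v-T-xJ_v$; this is the Laplacian matrix of a design obtained from the RGD by adding blocks of balanced incomplete block designs (designs with every pair of distinct treatments in the same number of blocks) of total pair concurrence $x-\lambda$. The $A$-value of a Laplacian matrix is the harmonic mean of its non-trivial eigenvalues, and its $D$-value is the product of its non-trivial eigenvalues; $A$-optimal ($D$-optimal) means maximal $A$-value ($D$-value) in the class considered. *)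

theory Defs
  imports
    "Jordan_Normal_Form.Char_Poly"
    "HOL-Library.Disjoint_Sets"
begin

text \<open>Treatments are the numbers \<open>{..<v}\<close>, so that they index the rows and columns of matrices.
  Blocks form a list because they may be repeated.\<close>

definition block_design :: "nat \<Rightarrow> nat \<Rightarrow> nat \<Rightarrow> nat set list \<Rightarrow> bool" where
  "block_design v b k Bs \<longleftrightarrow> k < v \<and> length Bs = b \<and> (\<forall>B\<in>set Bs. B \<subseteq> {..<v} \<and> card B = k)"

definition replication :: "nat set list \<Rightarrow> nat \<Rightarrow> nat" where
  "replication Bs i = card {j. j < length Bs \<and> i \<in> Bs ! j}"

definition incidence_mat :: "nat \<Rightarrow> nat set list \<Rightarrow> real mat" where
  "incidence_mat v Bs = mat v (length Bs) (\<lambda>(i, j). if i \<in> Bs ! j then 1 else 0)"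

definition design_laplacian :: "nat \<Rightarrow> nat \<Rightarrow> nat set list \<Rightarrow> real mat" where
  "design_laplacian v k Bs =
     real k \<cdot>\<^sub>m mat_diag v (\<lambda>i. real (replication Bs i)) -
     incidence_mat v Bs * transpose_mat (incidence_mat v Bs)"

definition laplacians :: "nat \<Rightarrow> nat \<Rightarrow> nat \<Rightarrow> real mat set" where
  "laplacians v b k = {design_laplacian v k Bs | Bs. block_design v b k Bs}"

text \<open>Laplacian matrices are real symmetric, so all their eigenvalues are real roots of the
  characteristic polynomial, and \<^const>\<open>proots\<close> counts them with multiplicity. One copy of \<open>0\<close>,
  which belongs to the all-ones vector, is removed.\<close>

definition nontrivial_eigenvalues :: "real mat \<Rightarrow> real list" where
  "nontrivial_eigenvalues L = sorted_list_of_multiset (proots (char_poly L) - {#0#})"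

definition elem_sym :: "nat \<Rightarrow> real list \<Rightarrow> real" where
  "elem_sym j xs = (\<Sum>I | I \<subseteq> {..<length xs} \<and> card I = j. \<Prod>i\<in>I. xs ! i)"

definition laplacians2 :: "nat \<Rightarrow> nat \<Rightarrow> nat \<Rightarrow> real mat set" where
  "laplacians2 v b k = {L \<in> laplacians v b k. \<forall>j\<in>{1, 2}. \<forall>L'\<in>laplacians v b k.
     elem_sym j (nontrivial_eigenvalues L') \<le> elem_sym j (nontrivial_eigenvalues L)}"

text \<open>The harmonic mean is taken to be \<open>0\<close> if one of the eigenvalues is \<open>0\<close> (disconnected designs);
  the eigenvalues of a Laplacian matrix are never negative.\<close>

definition A_value :: "real mat \<Rightarrow> real" where
  "A_value L = (let \<rho> = nontrivial_eigenvalues L in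
     if 0 \<in> set \<rho> then 0 else real (length \<rho>) / (\<Sum>r\<leftarrow>\<rho>. 1 / r))"

definition D_value :: "real mat \<Rightarrow> real" where
  "D_value L = prod_list (nontrivial_eigenvalues L)"

text \<open>Only used when \<open>v\<close> divides \<open>b * k\<close>, so that the first division below is exact; the second one
  is the floor in the definition of \<open>\<lambda>\<close>.\<close>

definition rgd_r :: "nat \<Rightarrow> nat \<Rightarrow> nat \<Rightarrow> nat" where
  "rgd_r v b k = b * k div v"

definition rgd_lambda :: "nat \<Rightarrow> nat \<Rightarrow> nat \<Rightarrow> nat" where
  "rgd_lambda v b k = rgd_r v b k * (k - 1) div (v - 1)"

definition rgd_delta :: "nat \<Rightarrow> nat \<Rightarrow> nat \<Rightarrow> nat" where
  "rgd_delta v b k = rgd_r v b k * (k - 1) - rgd_lambda v b k * (v - 1)"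

definition all_ones_mat :: "nat \<Rightarrow> real mat" where
  "all_ones_mat v = mat v v (\<lambda>_. 1)"

text \<open>The unique \<open>T\<close> with \<open>L = (\<delta> + v \<lambda>) I - T - \<lambda> J\<close>.\<close>

definition T_mat :: "nat \<Rightarrow> nat \<Rightarrow> nat \<Rightarrow> real mat \<Rightarrow> real mat" where
  "T_mat v b k L =
     real (rgd_delta v b k + v * rgd_lambda v b k) \<cdot>\<^sub>m 1\<^sub>m v
     - real (rgd_lambda v b k) \<cdot>\<^sub>m all_ones_mat v - L"

text \<open>\<open>L[x] = (\<delta> + v x) I - T - x J\<close>\<close>

definition lap_shift :: "nat \<Rightarrow> nat \<Rightarrow> nat \<Rightarrow> real mat \<Rightarrow> real \<Rightarrow> real mat" where
  "lap_shift v b k L x =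
     (real (rgd_delta v b k) + real v * x) \<cdot>\<^sub>m 1\<^sub>m v - T_mat v b k L - x \<cdot>\<^sub>m all_ones_mat v"

text \<open>The number of blocks of a design with Laplacian matrix \<open>L[x]\<close> depends on \<open>x\<close>, so it is left
  open here.\<close>

definition is_design_laplacian :: "nat \<Rightarrow> nat \<Rightarrow> real mat \<Rightarrow> bool" where
  "is_design_laplacian v k M \<longleftrightarrow> (\<exists>b. M \<in> laplacians v b k)"

text \<open>A graph on the vertices \<open>{..<v}\<close> is given by its adjacency relation.\<close>

definition graph_laplacian :: "nat \<Rightarrow> (nat \<Rightarrow> nat \<Rightarrow> bool) \<Rightarrow> real mat" where
  "graph_laplacian v E =
     mat_diag v (\<lambda>i. real (card {j. j < v \<and> E i j})) -
     mat v v (\<lambda>(i, j). if E i j then 1 else 0)"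

definition multipartite_adj :: "nat set set \<Rightarrow> nat \<Rightarrow> nat \<Rightarrow> bool" where
  "multipartite_adj P i j \<longleftrightarrow> (\<exists>A\<in>P. \<exists>B\<in>P. i \<in> A \<and> j \<in> B \<and> A \<noteq> B)"

end

theory Submission
  imports Defs "Jordan_Normal_Form.Schur_Decomposition" "HOL-Real_Asymp.Real_Asymp"
begin

text \<open>
  Passing from \<open>L\<close> to \<open>L[x]\<close> adds \<open>y = v (x - \<lambda>)\<close> to every non-trivial eigenvalue, and any
  \<open>x > \<lambda>\<close> is large enough. If \<open>L'\<close> has the same \<open>S\<^sub>1\<close> and \<open>S\<^sub>2\<close> as the multipartite Laplacian
  \<open>L\<close>, then comparing the traces of \<open>L'\<close> and its square with those of \<open>L\<close> shows that all
  concurrences in \<open>L'\<close> are 0 or 1, so the non-trivial eigenvalues of \<open>L'\<close> lie in \<open>[0, v]\<close>, whereas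
  those of \<open>L\<close> are \<open>v - \<alpha>\<close> and \<open>v\<close>. On \<open>[0, v]\<close> the function \<open>1 / (y + r)\<close> lies above the
  quadratic that touches it at \<open>v - \<alpha>\<close> and meets it at \<open>v\<close>; the sum of this quadratic over the
  spectrum is the same for \<open>L\<close> and \<open>L'\<close>, which gives A-optimality. The logarithm of the quotient of the D-value of
  \<open>L[x]\<close> by that of \<open>L'[x]\<close> is then antitone in \<open>y\<close> and tends to 0, which gives D-optimality.
\<close>

section \<open>Elementary symmetric polynomials and power sums\<close>

lemma elem_sym_0: "elem_sym 0 xs = 1"
proof -
  have "{I. I \<subseteq> {..<length xs} \<and> card I = 0} = {{}}"
    using finite_subset[of _ "{..<length xs}"] by auto
  then show ?thesis by (simp add: elem_sym_def)
qed

text \<open>An index set of size \<open>Suc j\<close> either avoids the last index \<open>n\<close>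
  or arises from a set of size \<open>j\<close> by inserting \<open>n\<close>.\<close>

lemma elem_sym_snoc: "elem_sym (Suc j) (xs @ [x]) = elem_sym (Suc j) xs + x * elem_sym j xs"
proof -
  define n where "n = length xs"
  have fin: "finite I" if "I \<subseteq> {..<n}" for I
    using that finite_subset by blast
  define U where "U = {I. I \<subseteq> {..<n} \<and> card I = Suc j}"
  define V where "V = {I. I \<subseteq> {..<n} \<and> card I = j}"
  have finU: "finite U" and finV: "finite V"
    by (auto simp: U_def V_def intro: finite_subset[of _ "Pow {..<n}"])
  have nV: "n \<notin> I" if "I \<in> V" for I using that by (auto simp: V_def)
  have split: "{I. I \<subseteq> {..<Suc n} \<and> card I = Suc j} = U \<union> insert n ` V" (is "?W = _")
  proof
    show "?W \<subseteq> U \<union> insert n ` V"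
    proof
      fix I assume I: "I \<in> ?W"
      show "I \<in> U \<union> insert n ` V"
      proof (cases "n \<in> I")
        case True
        have "I - {n} \<in> V" using I True by (auto simp: V_def less_Suc_eq)
        moreover have "I = insert n (I - {n})" using True by auto
        ultimately show ?thesis by blast
      next
        case False
        then show ?thesis using I by (auto simp: U_def less_Suc_eq)
      qed
    qed
    show "U \<union> insert n ` V \<subseteq> ?W"
      using fin by (auto simp: U_def V_def card_insert_if)
  qed
  have disj: "U \<inter> insert n ` V = {}" by (auto simp: U_def)
  have inj: "inj_on (insert n) V" using nV by (metis (no_types, lifting) Diff_insert_absorb inj_onI)
  let ?p = "\<lambda>I. \<Prod>i\<in>I. (xs @ [x]) ! i"
  have "elem_sym (Suc j) (xs @ [x]) = sum ?p U + sum ?p (insert n ` V)"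
    unfolding elem_sym_def using split disj finU finV by (simp add: n_def sum.union_disjoint)
  also have "sum ?p U = (\<Sum>I\<in>U. \<Prod>i\<in>I. xs ! i)"
    by (rule sum.cong[OF refl], rule prod.cong) (auto simp: U_def nth_append n_def)
  also have "sum ?p (insert n ` V) = (\<Sum>I\<in>V. ?p (insert n I))"
    using inj by (simp add: sum.reindex)
  also have "\<dots> = (\<Sum>I\<in>V. x * (\<Prod>i\<in>I. xs ! i))"
  proof (rule sum.cong[OF refl])
    fix I assume I: "I \<in> V"
    have "?p (insert n I) = x * ?p I"
      using nV[OF I] I fin by (simp add: V_def n_def)
    also have "?p I = (\<Prod>i\<in>I. xs ! i)"
      using I by (intro prod.cong) (auto simp: V_def nth_append n_def)
    finally show "?p (insert n I) = x * (\<Prod>i\<in>I. xs ! i)" .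
  qed
  also have "\<dots> = x * (\<Sum>I\<in>V. \<Prod>i\<in>I. xs ! i)"
    by (simp add: sum_distrib_left)
  finally show ?thesis by (simp add: elem_sym_def U_def V_def n_def)
qed

lemma elem_sym_Suc_Nil: "elem_sym (Suc j) [] = 0"
  by (simp add: elem_sym_def)

lemma elem_sym_1: "elem_sym 1 xs = sum_list xs"
  by (induction xs rule: rev_induct)
    (simp_all add: elem_sym_Suc_Nil elem_sym_snoc elem_sym_0)

text \<open>Newton's identity. With \<open>elem_sym_1\<close> it turns agreement in the first two
  symmetric polynomials into agreement of power sums, which are computable as traces.\<close>

lemma elem_sym_2: "2 * elem_sym 2 xs = (sum_list xs)\<^sup>2 - (\<Sum>r\<leftarrow>xs. r\<^sup>2)"
proof (induction xs rule: rev_induct)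
  case Nil
  show ?case by (simp add: numeral_2_eq_2 elem_sym_Suc_Nil)
next
  case (snoc x xs)
  have "elem_sym 2 (xs @ [x]) = elem_sym 2 xs + x * sum_list xs"
    using elem_sym_snoc[of 1 xs x] elem_sym_1[of xs] by (simp add: numeral_2_eq_2)
  with snoc show ?case by (simp add: power2_sum)
qed

section \<open>Comparison of reciprocal sums and products of shifted lists\<close>

lemma sum_list_quadratic:
  fixes xs :: "real list"
  shows "(\<Sum>r\<leftarrow>xs. A * r\<^sup>2 + B * r + C) = A * (\<Sum>r\<leftarrow>xs. r\<^sup>2) + B * sum_list xs + C * real (length xs)"
  by (induction xs) (simp_all add: algebra_simps)

text \<open>Hermite interpolation of \<open>1 / s\<close> with double node \<open>c\<close> and
  simple node \<open>a\<close>: the first fraction is the interpolant, the second the error. For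
  positive \<open>a\<close>, \<open>c\<close>, \<open>s\<close> the error has the sign of
  \<open>a - s\<close> or vanishes.\<close>

lemma reciprocal_minus_quadratic:
  fixes a c s :: real
  assumes "a \<noteq> 0" "c \<noteq> 0" "s \<noteq> 0"
  shows "1 / s = (s\<^sup>2 - (a + 2 * c) * s + (c\<^sup>2 + 2 * a * c)) / (c\<^sup>2 * a)
           + (s - c)\<^sup>2 * (a - s) / (c\<^sup>2 * a * s)"
  using assms by (simp add: divide_simps) (simp add: algebra_simps power2_eq_square)

lemma sum_reciprocal_le:
  fixes xs ys :: "real list" and c a y :: real
  assumes len: "length xs = length ys" and s1: "sum_list xs = sum_list ys"
    and s2: "(\<Sum>r\<leftarrow>xs. r\<^sup>2) = (\<Sum>r\<leftarrow>ys. r\<^sup>2)"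
    and xs: "set xs \<subseteq> {c, a}" and ys: "set ys \<subseteq> {0..a}"
    and "0 \<le> c" "0 \<le> a" "0 < y"
  shows "(\<Sum>r\<leftarrow>xs. 1 / (y + r)) \<le> (\<Sum>r\<leftarrow>ys. 1 / (y + r))"
proof -
  define p where "p = y + a"
  define q where "q = y + c"
  have pos: "p > 0" "q > 0" using assms by (auto simp: p_def q_def)
  \<comment> \<open>The interpolant above with nodes \<open>q\<close> and \<open>p\<close>,
    evaluated at \<open>y + r\<close>.\<close>
  define f where "f r = ((y + r)\<^sup>2 - (p + 2 * q) * (y + r) + (q\<^sup>2 + 2 * p * q)) / (q\<^sup>2 * p)" for r
  define K where "K = 1 / (q\<^sup>2 * p)"
  \<comment> \<open>Expanded in \<open>r\<close>, so that its sum over a list depends only on the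
    length and the first two power sums.\<close>
  have f: "f r = K * r\<^sup>2 + K * (2 * y - (p + 2 * q)) * r
      + K * (y\<^sup>2 - (p + 2 * q) * y + (q\<^sup>2 + 2 * p * q))" for r
    by (simp add: f_def K_def power2_sum algebra_simps add_divide_distrib diff_divide_distrib)
  have sum_f: "(\<Sum>r\<leftarrow>xs. f r) = (\<Sum>r\<leftarrow>ys. f r)"
    unfolding f sum_list_quadratic using len s1 s2 by simp
  have "(\<Sum>r\<leftarrow>xs. 1 / (y + r)) = (\<Sum>r\<leftarrow>xs. f r)"
  proof (intro arg_cong[where f = sum_list] map_cong refl)
    fix r assume "r \<in> set xs"
    then have "r = c \<or> r = a" using xs by auto
    then have "y + r \<noteq> 0" "(y + r - q)\<^sup>2 * (p - (y + r)) = 0"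
      using pos by (auto simp: p_def q_def)
    then show "1 / (y + r) = f r"
      using reciprocal_minus_quadratic[of p q "y + r"] pos by (simp add: f_def)
  qed
  also have "\<dots> = (\<Sum>r\<leftarrow>ys. f r)" by (rule sum_f)
  also have "\<dots> \<le> (\<Sum>r\<leftarrow>ys. 1 / (y + r))"
  proof (rule sum_list_mono)
    fix r assume "r \<in> set ys"
    then have r: "0 \<le> r" "r \<le> a" using ys by auto
    then have "0 \<le> (y + r - q)\<^sup>2 * (p - (y + r)) / (q\<^sup>2 * p * (y + r))"
      using pos \<open>0 < y\<close> by (simp add: p_def)
    then show "f r \<le> 1 / (y + r)"
      using reciprocal_minus_quadratic[of p q "y + r"] pos r \<open>0 < y\<close> by (simp add: f_def)
  qed
  finally show ?thesis .
qed

lemma sum_ln_has_derivative: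
  fixes xs :: "real list"
  assumes "\<forall>r\<in>set xs. 0 \<le> r" "0 < y"
  shows "((\<lambda>y. \<Sum>r\<leftarrow>xs. ln (y + r)) has_real_derivative (\<Sum>r\<leftarrow>xs. 1 / (y + r))) (at y)"
  using assms
proof (induction xs)
  case (Cons x xs)
  then have "y + x > 0" by (simp add: add_pos_nonneg)
  then have "((\<lambda>y. ln (y + x)) has_real_derivative 1 / (y + x)) (at y)"
    by (auto intro!: derivative_eq_intros)
  with Cons show ?case by (auto intro!: DERIV_add)
qed simp

text \<open>Each \<open>ln (y + r) - ln y\<close> tends to 0. For two lists of equal length the
  terms in \<open>ln y\<close> cancel, so the difference of their logarithmic sums tends to
  0.\<close>

lemma sum_ln_asymp:
  fixes xs :: "real list"
  shows "((\<lambda>y. (\<Sum>r\<leftarrow>xs. ln (y + r)) - real (length xs) * ln y) \<longlongrightarrow> 0) at_top"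
proof (induction xs)
  case (Cons x xs)
  have "((\<lambda>y. ln (y + x) - ln y) \<longlongrightarrow> 0) at_top" by real_asymp
  from tendsto_add[OF this Cons.IH] show ?case by (simp add: algebra_simps)
qed simp

lemma prod_list_exp_ln:
  fixes xs :: "real list"
  assumes "\<forall>r\<in>set xs. 0 < y + r"
  shows "prod_list (map ((+) y) xs) = exp (\<Sum>r\<leftarrow>xs. ln (y + r))"
  using assms by (induction xs) (simp_all add: exp_add)

lemma prod_shift_le:
  fixes xs ys :: "real list" and c a y :: real
  assumes len: "length xs = length ys" and s1: "sum_list xs = sum_list ys"
    and s2: "(\<Sum>r\<leftarrow>xs. r\<^sup>2) = (\<Sum>r\<leftarrow>ys. r\<^sup>2)"
    and xs: "set xs \<subseteq> {c, a}" and ys: "set ys \<subseteq> {0..a}"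
    and c: "0 \<le> c" and a: "0 \<le> a" and y: "0 < y"
  shows "prod_list (map ((+) y) ys) \<le> prod_list (map ((+) y) xs)"
proof -
  define h where "h t = (\<Sum>r\<leftarrow>xs. ln (t + r)) - (\<Sum>r\<leftarrow>ys. ln (t + r))" for t
  have nn: "\<forall>r\<in>set xs. 0 \<le> r" "\<forall>r\<in>set ys. 0 \<le> r" using xs ys c a by auto
  have antitone: "h t \<le> h y" if "y \<le> t" for t
  proof (rule DERIV_nonpos_imp_nonincreasing[OF that])
    fix s assume "y \<le> s" "s \<le> t"
    then have s: "0 < s" using y by simp
    have "(h has_real_derivative (\<Sum>r\<leftarrow>xs. 1 / (s + r)) - (\<Sum>r\<leftarrow>ys. 1 / (s + r))) (at s)"
      unfolding h_def by (intro DERIV_diff sum_ln_has_derivative nn s)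
    moreover have "(\<Sum>r\<leftarrow>xs. 1 / (s + r)) - (\<Sum>r\<leftarrow>ys. 1 / (s + r)) \<le> 0"
      using sum_reciprocal_le[OF len s1 s2 xs ys c a s] by simp
    ultimately show "\<exists>d. (h has_real_derivative d) (at s) \<and> d \<le> 0" by blast
  qed
  have "(h \<longlongrightarrow> 0) at_top"
    using tendsto_diff[OF sum_ln_asymp[of xs] sum_ln_asymp[of ys]] len by (simp add: h_def[abs_def])
  \<comment> \<open>From \<open>y\<close> onwards \<open>h\<close> is bounded above by
    \<open>h y\<close>, hence so is its limit 0.\<close>
  then have "0 \<le> h y"
    by (rule tendsto_upperbound)
      (auto intro: eventually_mono[OF eventually_ge_at_top[of y]] antitone)
  then show ?thesis
    using nn y by (simp add: prod_list_exp_ln add_pos_nonneg h_def)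
qed

section \<open>Real symmetric matrices: real spectrum and traces\<close>

lemma mult_mat_vec_sum:
  assumes "A \<in> carrier_mat n n" "x \<in> carrier_vec n" "i < n"
  shows "(A *\<^sub>v x) $ i = (\<Sum>j<n. A $$ (i, j) * x $ j)"
  using assms by (auto simp: scalar_prod_def lessThan_atLeast0)

lemma times_mat_sum:
  assumes "A \<in> carrier_mat n m" "B \<in> carrier_mat m p" "i < n" "j < p"
  shows "(A * B) $$ (i, j) = (\<Sum>k<m. A $$ (i, k) * B $$ (k, j))"
  using assms by (auto simp: scalar_prod_def lessThan_atLeast0)

text \<open>The characteristic polynomial splits over the complex numbers. For a root
  \<open>a\<close> with eigenvector \<open>x\<close>, the Hermitian form \<open>S\<close> of
  \<open>A\<close> at \<open>x\<close> equals \<open>a\<close> times the squared norm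
  \<open>N\<close> of \<open>x\<close>, and \<open>S\<close> is real, so \<open>a\<close> is
  real.\<close>

lemma symmetric_char_poly_splits:
  fixes A :: "real mat"
  assumes A: "A \<in> carrier_mat n n" and sym: "\<And>i j. i < n \<Longrightarrow> j < n \<Longrightarrow> A $$ (i, j) = A $$ (j, i)"
  shows "\<exists>es. char_poly A = (\<Prod>e\<leftarrow>es. [:- e, 1:]) \<and> length es = n"
proof -
  define C where "C = map_mat complex_of_real A"
  have C: "C \<in> carrier_mat n n" using A by (simp add: C_def)
  obtain as where as: "char_poly C = (\<Prod>a\<leftarrow>as. [:- a, 1:])" and len: "length as = n"
    using char_poly_factorized[OF C] by blast
  have real: "a \<in> \<real>" if a: "a \<in> set as" for a
  proof -
    have "poly (char_poly C) a = 0"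
      unfolding as poly_prod_list using a by (auto simp: prod_list_zero_iff)
    then obtain x where x: "x \<in> carrier_vec n" "x \<noteq> 0\<^sub>v n" "C *\<^sub>v x = a \<cdot>\<^sub>v x"
      using C by (auto simp: eigenvalue_root_char_poly[OF C, symmetric] eigenvalue_def eigenvector_def)
    define S where "S = (\<Sum>i<n. \<Sum>j<n. complex_of_real (A $$ (i, j)) * x $ j * cnj (x $ i))"
    define N where "N = (\<Sum>i<n. (cmod (x $ i))\<^sup>2)"
    obtain i where i: "i < n" "x $ i \<noteq> 0" using x by (metis carrier_vecD eq_vecI index_zero_vec)
    have "N > 0" unfolding N_def using i by (intro sum_pos2[of _ i]) auto
    have row: "(\<Sum>j<n. complex_of_real (A $$ (i, j)) * x $ j) = a * x $ i" if "i < n" for i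
    proof -
      have "(\<Sum>j<n. complex_of_real (A $$ (i, j)) * x $ j) = (C *\<^sub>v x) $ i"
        using mult_mat_vec_sum[OF C x(1) that] that A by (simp add: C_def)
      also have "\<dots> = a * x $ i" using x that by simp
      finally show ?thesis .
    qed
    have "S = (\<Sum>i<n. a * (x $ i * cnj (x $ i)))"
      unfolding S_def by (rule sum.cong) (simp_all add: row sum_distrib_right[symmetric])
    also have "\<dots> = a * complex_of_real N"
      by (simp add: N_def sum_distrib_left complex_norm_square[symmetric])
    finally have SN: "S = a * complex_of_real N" .
    \<comment> \<open>Conjugation fixes the real entries of \<open>A\<close> and exchanges the roles
      of \<open>i\<close> and \<open>j\<close>; symmetry of \<open>A\<close> then returns
      \<open>S\<close>.\<close>
    have "cnj S = (\<Sum>i<n. \<Sum>j<n. complex_of_real (A $$ (i, j)) * cnj (x $ j) * x $ i)"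
      by (simp add: S_def)
    also have "\<dots> = (\<Sum>j<n. \<Sum>i<n. complex_of_real (A $$ (i, j)) * cnj (x $ j) * x $ i)"
      by (rule sum.swap)
    also have "\<dots> = S"
      unfolding S_def by (intro sum.cong refl) (simp add: sym mult_ac)
    finally have "S \<in> \<real>" by (simp add: complex_is_Real_iff complex_cnj_cancel_iff complex_eq_iff)
    with SN \<open>N > 0\<close> have "a = S / complex_of_real N" by simp
    with \<open>S \<in> \<real>\<close> show ?thesis by simp
  qed
  define es where "es = map Re as"
  have as_es: "as = map complex_of_real es"
    unfolding es_def using real by (induction as) auto
  \<comment> \<open>Injectivity of the embedding on polynomials brings the factorization back to the
    reals.\<close>
  interpret h: map_poly_inj_idom_hom complex_of_real ..
  have "map_poly complex_of_real (char_poly A) = char_poly C"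
    unfolding C_def by (rule of_real_hom.char_poly_hom[OF A, symmetric])
  also have "\<dots> = (\<Prod>e\<leftarrow>es. [:- complex_of_real e, 1:])"
    unfolding as by (simp add: as_es o_def)
  also have "\<dots> = map_poly complex_of_real (\<Prod>e\<leftarrow>es. [:- e, 1:])"
    by (simp add: h.hom_prod_list o_def)
  finally have "char_poly A = (\<Prod>e\<leftarrow>es. [:- e, 1:])" by simp
  moreover have "length es = n" using len by (simp add: es_def)
  ultimately show ?thesis by blast
qed

lemma trace_mult_commute:
  fixes A B :: "'a :: comm_semiring_0 mat"
  assumes "A \<in> carrier_mat n m" "B \<in> carrier_mat m n"
  shows "(\<Sum>i<n. (A * B) $$ (i, i)) = (\<Sum>i<m. (B * A) $$ (i, i))"
proof -
  have "(\<Sum>i<n. (A * B) $$ (i, i)) = (\<Sum>i<n. \<Sum>k<m. A $$ (i, k) * B $$ (k, i))"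
    using assms by (intro sum.cong refl times_mat_sum) auto
  also have "\<dots> = (\<Sum>k<m. \<Sum>i<n. B $$ (k, i) * A $$ (i, k))"
    by (subst sum.swap) (simp add: mult.commute)
  also have "\<dots> = (\<Sum>k<m. (B * A) $$ (k, k))"
    using assms by (intro sum.cong refl times_mat_sum[symmetric]) auto
  finally show ?thesis .
qed

lemma trace_similar:
  fixes A :: "'a :: comm_ring_1 mat"
  assumes A: "A \<in> carrier_mat n n" and sim: "similar_mat_wit A B P Q"
  shows "(\<Sum>i<n. A $$ (i, i)) = (\<Sum>i<n. B $$ (i, i))"
proof -
  note D = similar_mat_witD2[OF A sim]
  have "(\<Sum>i<n. A $$ (i, i)) = (\<Sum>i<n. (P * (B * Q)) $$ (i, i))"
    using D by (simp add: assoc_mult_mat[of P n n B n Q n])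
  also have "\<dots> = (\<Sum>i<n. (B * Q * P) $$ (i, i))"
    using D by (intro trace_mult_commute) auto
  also have "B * Q * P = B"
    using D by (simp add: assoc_mult_mat[of B n n Q n P n])
  finally show ?thesis .
qed

text \<open>By Schur decomposition \<open>A\<close> is similar to an upper triangular
  \<open>B\<close> with diagonal \<open>es\<close>, and the same \<open>P\<close>, \<open>Q\<close>
  conjugate the squares. Traces are invariant under similarity.\<close>

lemma sum_eigenvalues:
  fixes A :: "real mat"
  assumes A: "A \<in> carrier_mat n n" and es: "char_poly A = (\<Prod>e\<leftarrow>es. [:- e, 1:])"
  shows "sum_list es = (\<Sum>i<n. A $$ (i, i))"
    and "(\<Sum>e\<leftarrow>es. e\<^sup>2) = (\<Sum>i<n. \<Sum>j<n. A $$ (i, j) * A $$ (j, i))"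
proof -
  obtain B P Q where "schur_decomposition A es = (B, P, Q)"
    using prod_cases3 by blast
  from schur_decomposition[OF A es this]
  have sim: "similar_mat_wit A B P Q" and ut: "upper_triangular B" and diag: "diag_mat B = es"
    by auto
  have B: "B \<in> carrier_mat n n" using similar_mat_witD2[OF A sim] by blast
  have es_eq: "es = map (\<lambda>i. B $$ (i, i)) [0..<n]"
    using diag B by (simp add: diag_mat_def)
  show "sum_list es = (\<Sum>i<n. A $$ (i, i))"
    unfolding trace_similar[OF A sim]
    by (simp add: es_eq interv_sum_list_conv_sum_set_nat lessThan_atLeast0)
  have sim2: "similar_mat_wit (A * A) (B * B) P Q"
    using similar_mat_wit_pow[OF sim, of 2] A B by (simp add: numeral_2_eq_2)
  have "(\<Sum>i<n. \<Sum>j<n. A $$ (i, j) * A $$ (j, i)) = (\<Sum>i<n. (A * A) $$ (i, i))"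
    using times_mat_sum[OF A A] by simp
  also have "\<dots> = (\<Sum>i<n. (B * B) $$ (i, i))"
    using A by (intro trace_similar[OF _ sim2]) auto
  also have "\<dots> = (\<Sum>i<n. (B $$ (i, i))\<^sup>2)"
  proof (rule sum.cong[OF refl])
    fix i assume "i \<in> {..<n}"
    then have i: "i < n" by simp
    have "(B * B) $$ (i, i) = (\<Sum>k<n. B $$ (i, k) * B $$ (k, i))"
      by (rule times_mat_sum[OF B B i i])
    \<comment> \<open>For \<open>k < i\<close> the first factor lies below the diagonal of
      \<open>B\<close>, for \<open>i < k\<close> the second one does.\<close>
    also have "\<dots> = (\<Sum>k<n. if k = i then (B $$ (i, i))\<^sup>2 else 0)"
    proof (rule sum.cong[OF refl])
      fix k assume "k \<in> {..<n}"
      then have "k < i \<Longrightarrow> B $$ (i, k) = 0" "i < k \<Longrightarrow> B $$ (k, i) = 0"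
        using ut B i by (auto simp: upper_triangular_def)
      then show "B $$ (i, k) * B $$ (k, i) = (if k = i then (B $$ (i, i))\<^sup>2 else 0)"
        by (cases k i rule: linorder_cases) (auto simp: power2_eq_square)
    qed
    also have "\<dots> = (B $$ (i, i))\<^sup>2" using i by simp
    finally show "(B * B) $$ (i, i) = (B $$ (i, i))\<^sup>2" .
  qed
  also have "\<dots> = (\<Sum>e\<leftarrow>es. e\<^sup>2)"
    by (simp add: es_eq o_def interv_sum_list_conv_sum_set_nat lessThan_atLeast0)
  finally show "(\<Sum>e\<leftarrow>es. e\<^sup>2) = (\<Sum>i<n. \<Sum>j<n. A $$ (i, j) * A $$ (j, i))" ..
qed

section \<open>The all-ones matrix\<close>

lemma all_ones_carrier [simp]: "all_ones_mat n \<in> carrier_mat n n"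
  by (simp add: all_ones_mat_def)

lemma all_ones_dim [simp]: "dim_row (all_ones_mat n) = n" "dim_col (all_ones_mat n) = n"
  by (simp_all add: all_ones_mat_def)

lemma all_ones_index [simp]:
  assumes "i < n" "j < n"
  shows "all_ones_mat n $$ (i, j) = 1"
  using assms by (simp add: all_ones_mat_def)

(* In the basis that replaces the first unit vector by the all-ones vector, the matrix
   becomes upper triangular. *)
lemma det_one_plus_all_ones:
  assumes n: "0 < n"
  shows "det (1\<^sub>m n + c \<cdot>\<^sub>m all_ones_mat n) = 1 + c * real n"
proof -
  let ?M = "1\<^sub>m n + c \<cdot>\<^sub>m all_ones_mat n"
  define E :: "real mat" where "E = mat n n (\<lambda>(i, j). if i = j \<or> j = 0 then 1 else 0)"
  \<comment> \<open>\<open>U\<close> is \<open>?M\<close> in the basis of columns of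
    \<open>E\<close>: the all-ones vector is multiplied by \<open>1 + c * real n\<close>, and every
    other unit vector gains \<open>c\<close> times the all-ones vector.\<close>
  define U where "U = mat n n (\<lambda>(i, j). (if i = j then 1 else 0) +
    (if i = 0 then c * (if j = 0 then real n else 1) else 0))"
  have carrier: "?M \<in> carrier_mat n n" "E \<in> carrier_mat n n" "U \<in> carrier_mat n n"
    by (auto simp: E_def U_def)
  have "det E = prod_list (diag_mat E)"
    by (rule det_lower_triangular[OF _ carrier(2)]) (simp add: E_def)
  also have "\<dots> = 1" by (simp add: prod_list_diag_prod E_def)
  finally have E: "det E = 1" .
  have "det U = prod_list (diag_mat U)"
    by (rule det_upper_triangular[OF _ carrier(3)]) (auto simp: U_def)
  also have "\<dots> = (\<Prod>i<n. if i = 0 then 1 + c * real n else 1)"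
    unfolding prod_list_diag_prod lessThan_atLeast0 by (rule prod.cong) (auto simp: U_def)
  also have "\<dots> = 1 + c * real n" using n by simp
  finally have U: "det U = 1 + c * real n" .
  have "?M * E = E * U"
  proof (rule eq_matI)
    fix i j assume "i < dim_row (E * U)" "j < dim_col (E * U)"
    then have ij: "i < n" "j < n" using carrier by auto
    have col: "(\<Sum>k<n. E $$ (k, j)) = (if j = 0 then real n else 1)"
    proof (cases "j = 0")
      case False
      then have "(\<Sum>k<n. E $$ (k, j)) = (\<Sum>k<n. if k = j then 1 else 0)"
        using ij by (intro sum.cong) (auto simp: E_def)
      then show ?thesis using False ij by simp
    qed (use ij in \<open>simp add: E_def\<close>)
    have "(?M * E) $$ (i, j) = (\<Sum>k<n. ?M $$ (i, k) * E $$ (k, j))"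
      by (rule times_mat_sum[OF carrier(1,2) ij])
    also have "\<dots> = (\<Sum>k<n. (if k = i then E $$ (k, j) else 0) + c * E $$ (k, j))"
      using ij by (intro sum.cong) (auto simp: algebra_simps)
    also have "\<dots> = E $$ (i, j) + c * (if j = 0 then real n else 1)"
      using ij by (simp add: sum.distrib col flip: sum_distrib_left)
    finally have lhs: "(?M * E) $$ (i, j) = E $$ (i, j) + c * (if j = 0 then real n else 1)" .
    have "(E * U) $$ (i, j) = (\<Sum>k<n. E $$ (i, k) * U $$ (k, j))"
      by (rule times_mat_sum[OF carrier(2,3) ij])
    also have "\<dots> = (\<Sum>k<n. (if k = j then E $$ (i, k) else 0) +
        (if k = 0 then c * (if j = 0 then real n else 1) else 0))"
      using ij by (intro sum.cong) (auto simp: E_def U_def)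
    also have "\<dots> = E $$ (i, j) + c * (if j = 0 then real n else 1)"
      using ij by (simp add: sum.distrib)
    finally show "(?M * E) $$ (i, j) = (E * U) $$ (i, j)" using lhs by simp
  qed (use carrier in auto)
  then have "det ?M * det E = det E * det U"
    by (simp only: det_mult[OF carrier(1,2), symmetric] det_mult[OF carrier(2,3), symmetric])
  then show ?thesis using E U by simp
qed

section \<open>Roots of split polynomials and a maximum principle\<close>

lemma prod_list_mset_cong:
  fixes f :: "'a \<Rightarrow> 'b :: comm_monoid_mult"
  assumes "mset xs = mset ys"
  shows "prod_list (map f xs) = prod_list (map f ys)"
  using assms by (metis mset_map prod_mset_prod_list)

lemma proots_linear_factors: "proots (\<Prod>e\<leftarrow>es. [:- e, 1:] :: 'a :: idom poly) = mset es"
proof (induction es)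
  case (Cons e es)
  have "(\<Prod>e\<leftarrow>es. [:- e, 1:] :: 'a poly) \<noteq> 0" by (auto simp: prod_list_zero_iff)
  with Cons show ?case by (simp add: proots_mult del: mult_pCons_left)
qed simp

lemma nontrivial_eigenvalues_eqI:
  assumes "char_poly A = [:0, 1:] * (\<Prod>e\<leftarrow>es. [:- e, 1:])"
  shows "nontrivial_eigenvalues A = sort es"
proof -
  have "char_poly A = (\<Prod>e\<leftarrow>0 # es. [:- e, 1:])" using assms by simp
  then have "proots (char_poly A) = mset (0 # es)" by (simp only: proots_linear_factors)
  then show ?thesis by (simp add: nontrivial_eigenvalues_def)
qed

text \<open>Maximum principle: where \<open>x\<close> attains a positive maximum \<open>x i\<close>,
  zero row sums give \<open>e * x i\<close> as the sum of \<open>M i j * (x j - x i)\<close>, and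
  off the diagonal both factors are nonpositive. If \<open>x\<close> has no positive entry,
  \<open>- x\<close> has one.\<close>

lemma zero_row_sum_eigenvalue_nonneg:
  fixes M :: "nat \<Rightarrow> nat \<Rightarrow> real"
  assumes off: "\<And>i j. i < n \<Longrightarrow> j < n \<Longrightarrow> i \<noteq> j \<Longrightarrow> M i j \<le> 0"
    and row: "\<And>i. i < n \<Longrightarrow> (\<Sum>j<n. M i j) = 0"
    and x: "\<exists>i<n. x i \<noteq> 0"
    and eig: "\<And>i. i < n \<Longrightarrow> (\<Sum>j<n. M i j * x j) = e * x i"
  shows "0 \<le> e"
proof -
  have main: "0 \<le> e" if x: "\<exists>i<n. 0 < x i"
    and eig: "\<And>i. i < n \<Longrightarrow> (\<Sum>j<n. M i j * x j) = e * x i" for x :: "nat \<Rightarrow> real"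
  proof -
    obtain i0 where i0: "i0 < n" "0 < x i0" using x by blast
    define m where "m = Max (x ` {..<n})"
    have "m \<in> x ` {..<n}" unfolding m_def using i0 by (intro Max_in) auto
    then obtain i where i: "i < n" "x i = m" by auto
    have le: "x j \<le> x i" if "j < n" for j unfolding i(2) m_def using that by (intro Max_ge) auto
    have xi: "0 < x i" using le[OF i0(1)] i0(2) by simp
    have "e * x i = (\<Sum>j<n. M i j * x j) - (\<Sum>j<n. M i j) * x i"
      using eig row i by simp
    also have "\<dots> = (\<Sum>j<n. M i j * (x j - x i))"
      by (simp add: sum_distrib_right sum_subtractf right_diff_distrib)
    also have "\<dots> \<ge> 0"
    proof (rule sum_nonneg)
      fix j assume j: "j \<in> {..<n}"
      then show "0 \<le> M i j * (x j - x i)"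
        using off[of i j] i le[of j] by (cases "i = j") (auto intro: mult_nonpos_nonpos)
    qed
    finally show ?thesis using xi by (simp add: zero_le_mult_iff)
  qed
  show ?thesis
  proof (cases "\<exists>i<n. 0 < x i")
    case True
    then show ?thesis using main eig by blast
  next
    case False
    then have "\<exists>i<n. 0 < - x i" using x by force
    moreover have "(\<Sum>j<n. M i j * - x j) = e * - x i" if "i < n" for i
      using eig[OF that] by (simp add: sum_negf)
    ultimately show ?thesis by (rule main)
  qed
qed

section \<open>Spectra of symmetric matrices with zero row sums\<close>

text \<open>Isolates the spectral features of Laplacians: symmetry makes the spectrum real, and zero
  row sums make the all-ones vector an eigenvector for 0.\<close>

locale zero_sum_symmetric =
  fixes A :: "real mat" and n :: nat
  assumes carrier: "A \<in> carrier_mat n n" and pos: "0 < n"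
    and sym: "i < n \<Longrightarrow> j < n \<Longrightarrow> A $$ (i, j) = A $$ (j, i)"
    and row_sum: "i < n \<Longrightarrow> (\<Sum>j<n. A $$ (i, j)) = 0"
begin

abbreviation spec :: "real list" where "spec \<equiv> nontrivial_eigenvalues A"

lemma eigenvalue_0: "poly (char_poly A) 0 = 0"
proof -
  define u :: "real vec" where "u = vec n (\<lambda>_. 1)"
  have u: "u \<in> carrier_vec n" by (simp add: u_def)
  have "A *\<^sub>v u = 0 \<cdot>\<^sub>v u"
  proof (rule eq_vecI)
    fix i assume "i < dim_vec (0 \<cdot>\<^sub>v u)"
    then have i: "i < n" by (simp add: u_def)
    have "(A *\<^sub>v u) $ i = (\<Sum>j<n. A $$ (i, j))"
      unfolding mult_mat_vec_sum[OF carrier u i] by (intro sum.cong) (auto simp: u_def)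
    then show "(A *\<^sub>v u) $ i = (0 \<cdot>\<^sub>v u) $ i" using row_sum i by (simp add: u_def)
  qed (use carrier in \<open>simp add: u_def\<close>)
  moreover have "u \<noteq> 0\<^sub>v n"
  proof
    assume "u = 0\<^sub>v n"
    then have "u $ 0 = 0\<^sub>v n $ 0" by simp
    then show False using pos by (simp add: u_def)
  qed
  ultimately have "eigenvector A u 0"
    using u carrier by (simp add: eigenvector_def)
  then show ?thesis
    using eigenvalue_root_char_poly[OF carrier] by (auto simp: eigenvalue_def)
qed

text \<open>Since 0 is a root, the multiset difference in \<open>nontrivial_eigenvalues\<close>
  really removes a root, and \<open>n - 1\<close> of them remain.\<close>

lemma char_poly_spec: "char_poly A = [:0, 1:] * (\<Prod>e\<leftarrow>spec. [:- e, 1:])"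
  and length_spec: "length spec = n - 1"
proof -
  obtain es where es: "char_poly A = (\<Prod>e\<leftarrow>es. [:- e, 1:])" and len: "length es = n"
    using symmetric_char_poly_splits[OF carrier sym] by blast
  have "0 \<in> set es"
    using eigenvalue_0 unfolding es poly_prod_list by (auto simp: prod_list_zero_iff)
  then have perm: "mset es = mset (0 # remove1 0 es)" by simp
  have spec_mset: "mset spec = mset (remove1 0 es)"
    by (simp add: nontrivial_eigenvalues_def es proots_linear_factors)
  then have "mset es = mset (0 # spec)" by (metis perm mset.simps(2))
  from prod_list_mset_cong[OF this, of "\<lambda>e. [:- e, 1:]"]
  show "char_poly A = [:0, 1:] * (\<Prod>e\<leftarrow>spec. [:- e, 1:])" unfolding es by simp
  have "length spec = length (remove1 0 es)" using spec_mset by (rule mset_eq_length)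
  then show "length spec = n - 1" using \<open>0 \<in> set es\<close> len by (simp add: length_remove1)
qed

text \<open>The removed eigenvalue 0 contributes nothing to power sums, so these are the traces of
  \<open>A\<close> and of its square.\<close>

lemma sum_spec: "sum_list spec = (\<Sum>i<n. A $$ (i, i))"
  and sum_squares_spec: "(\<Sum>e\<leftarrow>spec. e\<^sup>2) = (\<Sum>i<n. \<Sum>j<n. (A $$ (i, j))\<^sup>2)"
proof -
  have es: "char_poly A = (\<Prod>e\<leftarrow>0 # spec. [:- e, 1:])" using char_poly_spec by simp
  show "sum_list spec = (\<Sum>i<n. A $$ (i, i))"
    using sum_eigenvalues(1)[OF carrier es] by simp
  have "(\<Sum>e\<leftarrow>spec. e\<^sup>2) = (\<Sum>i<n. \<Sum>j<n. A $$ (i, j) * A $$ (j, i))"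
    using sum_eigenvalues(2)[OF carrier es] by simp
  also have "\<dots> = (\<Sum>i<n. \<Sum>j<n. (A $$ (i, j))\<^sup>2)"
    by (intro sum.cong refl) (simp add: sym power2_eq_square)
  finally show "(\<Sum>e\<leftarrow>spec. e\<^sup>2) = (\<Sum>i<n. \<Sum>j<n. (A $$ (i, j))\<^sup>2)" .
qed

text \<open>Adds \<open>y\<close> times the orthogonal projection onto the complement of the
  all-ones vector, which itself stays in the kernel.\<close>

definition shift :: "real \<Rightarrow> real mat" where
  "shift y = A + y \<cdot>\<^sub>m 1\<^sub>m n - (y / real n) \<cdot>\<^sub>m all_ones_mat n"

lemma shift_carrier [simp]: "shift y \<in> carrier_mat n n"
  using carrier by (auto simp: shift_def)

lemma shift_index:
  assumes "i < n" "j < n"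
  shows "shift y $$ (i, j) = A $$ (i, j) + (if i = j then y else 0) - y / real n"
  using assms carrier by (simp add: shift_def)

text \<open>With \<open>J\<close> the all-ones matrix, \<open>A J = 0\<close> yields
  \<open>t I - shift y = ((t - y) I - A) (I + c J)\<close> as soon as
  \<open>c (t - y) = y / n\<close>; this \<open>c\<close> exists because
  \<open>t \<noteq> y\<close>.\<close>

lemma char_poly_shift_poly:
  assumes t: "t \<noteq> y"
  shows "poly (char_poly (shift y)) t = t * (\<Prod>e\<leftarrow>spec. t - (y + e))"
proof -
  define c where "c = y / (real n * (t - y))"
  let ?C = "- char_matrix A (t - y)"
  let ?D = "1\<^sub>m n + c \<cdot>\<^sub>m all_ones_mat n"
  have C: "?C \<in> carrier_mat n n" using carrier by (simp add: char_matrix_def)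
  have D: "?D \<in> carrier_mat n n" by auto
  have idx: "?C $$ (i, k) = (if i = k then t - y else 0) - A $$ (i, k)" if "i < n" "k < n" for i k
    using that carrier by (simp add: char_matrix_def)
  have "- char_matrix (shift y) t = ?C * ?D"
  proof (rule eq_matI)
    fix i j assume "i < dim_row (?C * ?D)" "j < dim_col (?C * ?D)"
    then have ij: "i < n" "j < n" using C D by auto
    have "(?C * ?D) $$ (i, j) = (\<Sum>k<n. ?C $$ (i, k) * ?D $$ (k, j))"
      by (rule times_mat_sum[OF C D ij])
    also have "\<dots> = (\<Sum>k<n. (if k = j then ?C $$ (i, j) else 0)
        + c * ((if k = i then t - y else 0) - A $$ (i, k)))"
      using ij by (intro sum.cong refl) (auto simp: idx algebra_simps simp del: index_uminus_mat)
    also have "\<dots> = ?C $$ (i, j) + c * ((\<Sum>k<n. if k = i then t - y else 0) - (\<Sum>k<n. A $$ (i, k)))"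
      using ij by (simp add: sum.distrib sum_subtractf del: index_uminus_mat flip: sum_distrib_left)
    also have "\<dots> = ?C $$ (i, j) + c * (t - y)"
      using ij by (simp add: row_sum del: index_uminus_mat)
    also have "c * (t - y) = y / real n" using t by (simp add: c_def)
    finally have "(?C * ?D) $$ (i, j) = (if i = j then t - y else 0) - A $$ (i, j) + y / real n"
      using ij by (simp only: idx)
    moreover have "(- char_matrix (shift y) t) $$ (i, j) = (if i = j then t else 0) - shift y $$ (i, j)"
      using ij shift_carrier[of y] by (simp add: char_matrix_def del: shift_carrier)
    ultimately show "(- char_matrix (shift y) t) $$ (i, j) = (?C * ?D) $$ (i, j)"
      using ij by (simp add: shift_index)
  qed (use C D shift_carrier[of y] in \<open>auto simp: char_matrix_def simp del: shift_carrier\<close>)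
  then have "poly (char_poly (shift y)) t = det ?C * det ?D"
    using det_mult[OF C D] by (simp add: char_poly_matrix[OF shift_carrier])
  also have "det ?C = poly (char_poly A) (t - y)"
    by (simp add: char_poly_matrix[OF carrier])
  also have "\<dots> = (t - y) * (\<Prod>e\<leftarrow>spec. t - (y + e))"
    by (simp add: char_poly_spec poly_prod_list o_def algebra_simps)
  \<comment> \<open>This determinant is \<open>t / (t - y)\<close>: it trades the factor
    \<open>t - y\<close>, from the eigenvalue 0 of \<open>A\<close>, for the factor
    \<open>t\<close>.\<close>
  also have "det ?D = 1 + c * real n" by (rule det_one_plus_all_ones[OF pos])
  also have "\<dots> = t / (t - y)" using t pos by (simp add: c_def field_simps)
  finally show ?thesis using t by simp
qed

text \<open>Both polynomials agree at every point except possibly \<open>y\<close>, so their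
  difference has infinitely many roots.\<close>

lemma char_poly_shift: "char_poly (shift y) = [:0, 1:] * (\<Prod>e\<leftarrow>map ((+) y) spec. [:- e, 1:])"
  (is "?p = ?q")
proof (rule ccontr)
  assume "?p \<noteq> ?q"
  then have "finite {t. poly (?p - ?q) t = 0}" by (intro poly_roots_finite) simp
  moreover have "UNIV - {y} \<subseteq> {t. poly (?p - ?q) t = 0}"
    by (auto simp: char_poly_shift_poly poly_prod_list o_def algebra_simps)
  ultimately have "finite (UNIV - {y})" using finite_subset by blast
  then show False by (simp add: infinite_UNIV_char_0)
qed

text \<open>Adding a constant keeps \<open>spec\<close> sorted, so the lists agree and not only the
  multisets.\<close>

lemma nontrivial_eigenvalues_shift: "nontrivial_eigenvalues (shift y) = map ((+) y) spec"
proof -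
  have "sorted (map ((+) y) spec)"
    by (simp add: sorted_map nontrivial_eigenvalues_def)
  then show ?thesis
    using nontrivial_eigenvalues_eqI[OF char_poly_shift] by (simp add: sorted_sort_id)
qed

(* For a shift that moves e away from 0, e + y is an eigenvalue of the shifted matrix, and its
   eigenvectors are automatically orthogonal to the all-ones vector. This also covers e = 0. *)
lemma nontrivial_eigenvector:
  assumes "e \<in> set spec"
  obtains x where "\<exists>i<n. x i \<noteq> 0" "(\<Sum>i<n. x i) = 0"
    "\<And>i. i < n \<Longrightarrow> (\<Sum>j<n. A $$ (i, j) * x j) = e * x i"
proof -
  \<comment> \<open>This shift moves the eigenvalue \<open>e\<close> to 1.\<close>
  define y where "y = 1 - e"
  have "poly (char_poly (shift y)) 1 = 0"
    using assms unfolding char_poly_shift poly_mult poly_prod_list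
    by (auto simp: prod_list_zero_iff y_def o_def image_iff)
  then obtain w where w: "w \<in> carrier_vec n" "w \<noteq> 0\<^sub>v n" "shift y *\<^sub>v w = 1 \<cdot>\<^sub>v w"
    using shift_carrier[of y]
    by (auto simp: eigenvalue_root_char_poly[OF shift_carrier, symmetric] eigenvalue_def
        eigenvector_def simp del: shift_carrier)
  define x where "x i = w $ i" for i
  define s where "s = (\<Sum>i<n. x i)"
  have row: "(\<Sum>j<n. A $$ (i, j) * x j) + y * x i - y / real n * s = x i" if i: "i < n" for i
  proof -
    have "x i = (shift y *\<^sub>v w) $ i" using w i by (simp add: x_def)
    also have "\<dots> = (\<Sum>j<n. shift y $$ (i, j) * x j)"
      unfolding x_def by (rule mult_mat_vec_sum[OF shift_carrier w(1) i])
    also have "\<dots> = (\<Sum>j<n. A $$ (i, j) * x j + (if j = i then y * x i else 0) - y / real n * x j)"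
      using i by (intro sum.cong refl) (auto simp: shift_index algebra_simps)
    also have "\<dots> = (\<Sum>j<n. A $$ (i, j) * x j) + y * x i - y / real n * s"
      using i by (simp add: sum.distrib sum_subtractf s_def sum_distrib_left)
    finally show ?thesis ..
  qed
  \<comment> \<open>Summing all rows: the column sums of \<open>A\<close> vanish by symmetry and the
    two terms in \<open>y\<close> cancel, which leaves \<open>s = 0\<close>.\<close>
  have "s = (\<Sum>i<n. (\<Sum>j<n. A $$ (i, j) * x j) + y * x i - y / real n * s)"
    unfolding s_def[symmetric] using row by (simp add: s_def)
  also have "\<dots> = (\<Sum>i<n. \<Sum>j<n. A $$ (i, j) * x j) + y * s - y * s"
    using pos by (simp add: sum.distrib sum_subtractf s_def sum_distrib_left)
  also have "(\<Sum>i<n. \<Sum>j<n. A $$ (i, j) * x j) = (\<Sum>j<n. (\<Sum>i<n. A $$ (j, i)) * x j)"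
    by (subst sum.swap) (simp add: sum_distrib_right sym)
  also have "\<dots> = 0" by (simp add: row_sum)
  finally have s0: "s = 0" by simp
  show thesis
  proof (rule that)
    show "\<exists>i<n. x i \<noteq> 0"
      using w unfolding x_def by (metis carrier_vecD eq_vecI index_zero_vec)
    show "(\<Sum>i<n. x i) = 0" using s0 by (simp add: s_def)
    show "(\<Sum>j<n. A $$ (i, j) * x j) = e * x i" if "i < n" for i
      using row[OF that] s0 by (simp add: y_def algebra_simps)
  qed
qed

text \<open>Entries in \<open>{-1..0}\<close> make the off-diagonal signs right for both
  \<open>A\<close> and its complement. An eigenvector with zero sum serves both, with eigenvalues
  \<open>e\<close> and \<open>n - e\<close>.\<close>

lemma spec_bounds:
  assumes off: "\<And>i j. i < n \<Longrightarrow> j < n \<Longrightarrow> i \<noteq> j \<Longrightarrow> A $$ (i, j) \<in> {-1..0}"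
  shows "set spec \<subseteq> {0..real n}"
proof
  fix e assume "e \<in> set spec"
  then obtain x where x: "\<exists>i<n. x i \<noteq> 0" "(\<Sum>i<n. x i) = 0"
    "\<And>i. i < n \<Longrightarrow> (\<Sum>j<n. A $$ (i, j) * x j) = e * x i"
    using nontrivial_eigenvector by blast
  have "0 \<le> e"
    by (rule zero_row_sum_eigenvalue_nonneg[of n "\<lambda>i j. A $$ (i, j)", OF _ row_sum x(1,3)])
       (use off in force)+
  (* n I - J - A is the Laplacian of the complement. *)
  moreover have "0 \<le> real n - e"
  proof (rule zero_row_sum_eigenvalue_nonneg[of n "\<lambda>i j. (if i = j then real n else 0) - 1 - A $$ (i, j)" x])
    fix i assume i: "i < n"
    show "(\<Sum>j<n. (if i = j then real n else 0) - 1 - A $$ (i, j)) = 0"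
      using i row_sum by (simp add: sum_subtractf)
    have "(\<Sum>j<n. ((if i = j then real n else 0) - 1 - A $$ (i, j)) * x j)
        = (\<Sum>j<n. (if j = i then real n * x i else 0) - x j - A $$ (i, j) * x j)"
      by (intro sum.cong refl) (auto simp: algebra_simps)
    also have "\<dots> = (real n - e) * x i"
      using i x by (simp add: sum_subtractf algebra_simps)
    finally show "(\<Sum>j<n. ((if i = j then real n else 0) - 1 - A $$ (i, j)) * x j) = (real n - e) * x i" .
  next
    fix i j assume "i < n" "j < n" "i \<noteq> j"
    with off show "(if i = j then real n else 0) - 1 - A $$ (i, j) \<le> 0" by force
  qed (rule x(1))
  ultimately show "e \<in> {0..real n}" by simp
qed

end

section \<open>Laplacian matrices of block designs\<close>

text \<open>The sum over blocks is the concurrence of \<open>i\<close> and \<open>j\<close>, which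
  for \<open>i = j\<close> is the replication number.\<close>

lemma design_laplacian_index:
  assumes "i < v" "j < v"
  shows "design_laplacian v k Bs $$ (i, j) = (if i = j then real (k * replication Bs i) else 0)
    - (\<Sum>l<length Bs. of_bool (i \<in> Bs ! l) * of_bool (j \<in> Bs ! l))"
proof -
  let ?N = "incidence_mat v Bs"
  have N: "?N \<in> carrier_mat v (length Bs)" by (simp add: incidence_mat_def)
  have "(?N * transpose_mat ?N) $$ (i, j) = (\<Sum>l<length Bs. ?N $$ (i, l) * transpose_mat ?N $$ (l, j))"
    using N assms by (intro times_mat_sum[of _ v _ _ v]) auto
  also have "\<dots> = (\<Sum>l<length Bs. of_bool (i \<in> Bs ! l) * of_bool (j \<in> Bs ! l))"
    using assms by (intro sum.cong) (auto simp: incidence_mat_def)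
  finally have NN: "(?N * transpose_mat ?N) $$ (i, j) =
    (\<Sum>l<length Bs. of_bool (i \<in> Bs ! l) * of_bool (j \<in> Bs ! l))" .
  have "design_laplacian v k Bs $$ (i, j) =
      real k * mat_diag v (\<lambda>i. real (replication Bs i)) $$ (i, j) - (?N * transpose_mat ?N) $$ (i, j)"
    using assms N by (simp add: design_laplacian_def mat_diag_def)
  then show ?thesis unfolding NN using assms by (simp add: mat_diag_def)
qed

lemma replication_sum: "real (replication Bs i) = (\<Sum>l<length Bs. of_bool (i \<in> Bs ! l))"
  by (simp add: replication_def sum_of_bool_eq Int_def)

text \<open>Each block containing \<open>i\<close> has \<open>k\<close> treatments, so the
  concurrences in row \<open>i\<close> add up to \<open>k\<close> times the replication of
  \<open>i\<close>, which cancels the diagonal term.\<close>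

lemma laplacian_zero_sum_symmetric:
  assumes L: "L \<in> laplacians v b k" and v: "0 < v"
  shows "zero_sum_symmetric L v"
proof -
  obtain Bs where L_eq: "L = design_laplacian v k Bs" and Bs: "block_design v b k Bs"
    using L by (auto simp: laplacians_def)
  have block: "(\<Sum>j<v. of_bool (j \<in> Bs ! l)) = real k" if "l < length Bs" for l
  proof -
    have "Bs ! l \<subseteq> {..<v}" "card (Bs ! l) = k"
      using Bs that by (auto simp: block_design_def)
    moreover from this have "{..<v} \<inter> {j. j \<in> Bs ! l} = Bs ! l" by auto
    ultimately show ?thesis by (simp add: sum_of_bool_eq)
  qed
  show ?thesis
  proof
    show "L \<in> carrier_mat v v"
      by (auto simp: L_eq design_laplacian_def incidence_mat_def mat_diag_def)
  next
    fix i j assume "i < v" "j < v"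
    then show "L $$ (i, j) = L $$ (j, i)"
      by (simp add: L_eq design_laplacian_index mult.commute)
  next
    fix i assume i: "i < v"
    have "(\<Sum>j<v. \<Sum>l<length Bs. of_bool (i \<in> Bs ! l) * of_bool (j \<in> Bs ! l) :: real)
        = (\<Sum>l<length Bs. of_bool (i \<in> Bs ! l) * (\<Sum>j<v. of_bool (j \<in> Bs ! l)))"
      by (subst sum.swap) (simp only: sum_distrib_left)
    also have "\<dots> = (\<Sum>l<length Bs. of_bool (i \<in> Bs ! l) * real k)"
      by (intro sum.cong) (simp_all only: block lessThan_iff)
    also have "\<dots> = real (k * replication Bs i)"
      unfolding of_nat_mult replication_sum sum_distrib_left by (simp only: mult.commute)
    finally show "(\<Sum>j<v. L $$ (i, j)) = 0"
      using i by (simp add: L_eq design_laplacian_index sum_subtractf)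
  qed (rule v)
qed

lemma laplacian_off_diagonal:
  assumes "L \<in> laplacians v b k" "i < v" "j < v" "i \<noteq> j"
  shows "\<exists>c::nat. L $$ (i, j) = - real c"
proof -
  obtain Bs where L_eq: "L = design_laplacian v k Bs"
    using assms by (auto simp: laplacians_def)
  have "L $$ (i, j) = - real (\<Sum>l<length Bs. of_bool (i \<in> Bs ! l) * of_bool (j \<in> Bs ! l))"
    using assms by (simp add: L_eq design_laplacian_index)
  then show ?thesis by blast
qed

text \<open>An off-diagonal entry \<open>- c\<close> with \<open>c\<close> a natural number has
  \<open>c\<^sup>2 - c \<ge> 0\<close>, with equality only for \<open>c\<close> equal to 0 or 1. By
  the trace conditions and zero row sums, these terms together with the squares of
  \<open>A $$ (i, i) - d\<close> sum to 0, so each of them vanishes.\<close>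

lemma (in zero_sum_symmetric) off_diagonal_01:
  assumes off: "\<And>i j. i < n \<Longrightarrow> j < n \<Longrightarrow> i \<noteq> j \<Longrightarrow> \<exists>c::nat. A $$ (i, j) = - real c"
    and tr: "(\<Sum>i<n. A $$ (i, i)) = real n * d"
    and tr2: "(\<Sum>i<n. \<Sum>j<n. (A $$ (i, j))\<^sup>2) = real n * (d\<^sup>2 + d)"
    and ij: "i < n" "j < n" "i \<noteq> j"
  shows "A $$ (i, j) \<in> {-1..0}"
proof -
  define g where "g i j = (if j = i then (A $$ (i, i) - d)\<^sup>2 else (A $$ (i, j))\<^sup>2 + A $$ (i, j))" for i j
  have g_nonneg: "0 \<le> g i j" if ij: "i < n" "j < n" for i j
  proof (cases "j = i")
    case False
    then obtain c :: nat where c: "A $$ (i, j) = - real c" using off ij by metis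
    have "real c \<le> real (c\<^sup>2)" unfolding of_nat_le_iff by (simp add: power2_eq_square)
    then show ?thesis using c False by (simp add: g_def)
  qed (simp add: g_def)
  \<comment> \<open>The diagonal correction comes from \<open>(a - d)\<^sup>2 = a\<^sup>2 + a +
    d\<^sup>2 - (2 * d + 1) * a\<close>.\<close>
  have "(\<Sum>i<n. \<Sum>j<n. g i j) = (\<Sum>i<n. \<Sum>j<n. (A $$ (i, j))\<^sup>2 + A $$ (i, j)
      + (if j = i then d\<^sup>2 - (2 * d + 1) * A $$ (i, i) else 0))"
    by (intro sum.cong refl) (auto simp: g_def power2_eq_square algebra_simps)
  also have "\<dots> = (\<Sum>i<n. \<Sum>j<n. (A $$ (i, j))\<^sup>2) + (\<Sum>i<n. d\<^sup>2 - (2 * d + 1) * A $$ (i, i))"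
    by (simp add: sum.distrib row_sum)
  also have "\<dots> = 0"
    by (simp add: tr2 sum_subtractf tr flip: sum_distrib_left)
       (simp add: algebra_simps power2_eq_square)
  finally have "(\<Sum>i<n. \<Sum>j<n. g i j) = 0" .
  moreover have "0 \<le> (\<Sum>j<n. g i j)" if "i < n" for i
    using g_nonneg that by (intro sum_nonneg) auto
  ultimately have "(\<Sum>j<n. g i j) = 0"
    using sum_nonneg_eq_0_iff[of "{..<n}" "\<lambda>i. \<Sum>j<n. g i j"] ij by auto
  then have "g i j = 0"
    using sum_nonneg_eq_0_iff[of "{..<n}" "g i"] ij g_nonneg by auto
  then have "A $$ (i, j) * (A $$ (i, j) + 1) = 0"
    using ij by (simp add: g_def power2_eq_square algebra_simps)
  then show ?thesis by auto
qed

section \<open>The Laplacian of the complete multipartite graph\<close>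

text \<open>The neighbours of \<open>i\<close> are exactly the vertices outside its class
  \<open>A\<close>, so its degree is \<open>v - a\<close>.\<close>

lemma multipartite_laplacian_index:
  assumes P: "partition_on {..<v} P" and card: "\<forall>A\<in>P. card A = a"
    and i: "i \<in> A" "A \<in> P" and j: "j < v"
  shows "graph_laplacian v (multipartite_adj P) $$ (i, j) =
    (if i = j then real v - real a else 0) - of_bool (j \<notin> A)"
proof -
  have A: "A \<subseteq> {..<v}" using P i by (auto simp: partition_on_def)
  have uniq: "B = C" if "B \<in> P" "C \<in> P" "t \<in> B" "t \<in> C" for B C t
    using P that by (auto simp: partition_on_def disjoint_def)
  have adj: "multipartite_adj P i t \<longleftrightarrow> t \<notin> A" if t: "t < v" for t
  proof -
    obtain B where "B \<in> P" "t \<in> B" using P t by (auto simp: partition_on_def)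
    then show ?thesis unfolding multipartite_adj_def using uniq i by metis
  qed
  have "{t. t < v \<and> multipartite_adj P i t} = {..<v} - A" using adj by auto
  moreover have "card ({..<v} - A) = v - a"
    using A card i by (simp add: card_Diff_subset finite_subset[OF A])
  moreover have "a \<le> v" using A card i card_mono[OF finite_lessThan A] by simp
  ultimately have "real (card {t. t < v \<and> multipartite_adj P i t}) = real v - real a" by simp
  moreover have "i < v" using A i by auto
  ultimately show ?thesis using j adj[OF j] i by (auto simp: graph_laplacian_def mat_diag_def)
qed

text \<open>For an eigenvector with zero sum, the equation at a vertex \<open>t\<close> of a class
  \<open>A\<close> reads \<open>d * x t = s\<close>, where \<open>s\<close> is the sum of
  \<open>x\<close> over \<open>A\<close> and \<open>d = e - (v - a)\<close>. Summing over
  \<open>A\<close> gives \<open>d * s = a * s\<close>.\<close>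

lemma multipartite_spec:
  assumes P: "partition_on {..<v} P" and card: "\<forall>A\<in>P. card A = a"
    and L: "L = graph_laplacian v (multipartite_adj P)" and zs: "zero_sum_symmetric L v"
  shows "set (nontrivial_eigenvalues L) \<subseteq> {real v - real a, real v}"
proof
  interpret zero_sum_symmetric L v by (rule zs)
  fix e assume "e \<in> set (nontrivial_eigenvalues L)"
  then obtain x where x: "\<exists>i<v. x i \<noteq> 0" "(\<Sum>i<v. x i) = 0"
    "\<And>i. i < v \<Longrightarrow> (\<Sum>j<v. L $$ (i, j) * x j) = e * x i"
    using nontrivial_eigenvector by blast
  then obtain i where i: "i < v" "x i \<noteq> 0" by blast
  then obtain A where A: "A \<in> P" "i \<in> A" using P by (auto simp: partition_on_def)
  have sub: "A \<subseteq> {..<v}" using P A by (auto simp: partition_on_def)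
  define d where "d = e - (real v - real a)"
  define s where "s = sum x A"
  have row: "d * x t = s" if t: "t \<in> A" for t
  proof -
    have tv: "t < v" using t sub by auto
    have "e * x t = (\<Sum>j<v. L $$ (t, j) * x j)" using x tv by simp
    also have "\<dots> = (\<Sum>j<v. (if j = t then (real v - real a) * x t else 0) - x j + of_bool (j \<in> A) * x j)"
      by (intro sum.cong refl)
         (use t in \<open>auto simp: L multipartite_laplacian_index[OF P card t A(1)] left_diff_distrib\<close>)
    also have "\<dots> = (real v - real a) * x t + (\<Sum>j<v. of_bool (j \<in> A) * x j)"
      using tv x by (simp add: sum.distrib sum_subtractf)
    also have "(\<Sum>j<v. of_bool (j \<in> A) * x j) = s"
      unfolding s_def using sub by (intro sum.mono_neutral_cong_right) auto
    finally show ?thesis by (simp add: d_def algebra_simps)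
  qed
  have "d * s = (\<Sum>t\<in>A. d * x t)" by (simp add: s_def sum_distrib_left)
  also have "\<dots> = real a * s" using row card A by simp
  finally have "(d - real a) * s = 0" by (simp add: algebra_simps)
  \<comment> \<open>If \<open>s = 0\<close>, then \<open>d * x i = 0\<close> with
    \<open>x i \<noteq> 0\<close>, which is why the class of such an \<open>i\<close> was
    chosen.\<close>
  then have "d = 0 \<or> d = real a" using row[OF A(2)] i by auto
  then show "e \<in> {real v - real a, real v}" by (auto simp: d_def)
qed

text \<open>These are the trace conditions of \<open>off_diagonal_01\<close>. Off-diagonal entries
  are 0 or -1, so their squares are their negatives; zero row sums do the rest.\<close>

lemma multipartite_traces:
  assumes P: "partition_on {..<v} P" and card: "\<forall>A\<in>P. card A = a"
    and L: "L = graph_laplacian v (multipartite_adj P)" and zs: "zero_sum_symmetric L v"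
  defines "d \<equiv> real v - real a"
  shows "(\<Sum>i<v. L $$ (i, i)) = real v * d"
    and "(\<Sum>i<v. \<Sum>j<v. (L $$ (i, j))\<^sup>2) = real v * (d\<^sup>2 + d)"
proof -
  interpret zero_sum_symmetric L v by (rule zs)
  have ex: "\<exists>A\<in>P. i \<in> A" if "i < v" for i using P that by (auto simp: partition_on_def)
  have diag: "L $$ (i, i) = d" if "i < v" for i
    using ex[OF that] multipartite_laplacian_index[OF P card _ _ that] by (auto simp: L d_def)
  then show "(\<Sum>i<v. L $$ (i, i)) = real v * d" by simp
  have sq: "(L $$ (i, j))\<^sup>2 = (if j = i then d\<^sup>2 + d else 0) - L $$ (i, j)" if ij: "i < v" "j < v" for i j
  proof -
    obtain A where "A \<in> P" "i \<in> A" using ex[OF ij(1)] by blast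
    then show ?thesis
      using multipartite_laplacian_index[OF P card _ _ ij(2), of i A] diag[OF ij(1)]
      by (auto simp: L)
  qed
  have "(\<Sum>i<v. \<Sum>j<v. (L $$ (i, j))\<^sup>2) = (\<Sum>i<v. \<Sum>j<v. (if j = i then d\<^sup>2 + d else 0) - L $$ (i, j))"
    by (intro sum.cong refl sq) auto
  also have "\<dots> = real v * (d\<^sup>2 + d)" by (simp add: sum_subtractf row_sum)
  finally show "(\<Sum>i<v. \<Sum>j<v. (L $$ (i, j))\<^sup>2) = real v * (d\<^sup>2 + d)" .
qed

section \<open>The matrices \<open>L[x]\<close> and the optimality theorem\<close>

text \<open>Unfolding \<open>T_mat\<close> cancels \<delta>: with \<lambda> for
  \<open>rgd_lambda n b k\<close>, \<open>L[x]\<close> is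
  \<open>L + n (x - \<lambda>) I - (x - \<lambda>) J\<close>, an instance of
  \<open>shift\<close>.\<close>

lemma (in zero_sum_symmetric) nontrivial_eigenvalues_lap_shift:
  "nontrivial_eigenvalues (lap_shift n b k A x) =
     map ((+) (real n * (x - real (rgd_lambda n b k)))) spec"
proof -
  have "lap_shift n b k A x = shift (real n * (x - real (rgd_lambda n b k)))"
  proof (rule eq_matI)
    fix i j assume "i < dim_row (shift (real n * (x - real (rgd_lambda n b k))))"
      "j < dim_col (shift (real n * (x - real (rgd_lambda n b k))))"
    then have ij: "i < n" "j < n" by (simp_all add: carrier_matD[OF shift_carrier])
    have "shift (real n * (x - real (rgd_lambda n b k))) $$ (i, j) = A $$ (i, j)
        + (if i = j then real n * (x - real (rgd_lambda n b k)) else 0) - (x - real (rgd_lambda n b k))"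
      using pos by (simp add: shift_index[OF ij])
    then show "lap_shift n b k A x $$ (i, j) = shift (real n * (x - real (rgd_lambda n b k))) $$ (i, j)"
      using ij carrier by (simp only:) (simp add: lap_shift_def T_mat_def algebra_simps)
  qed (simp_all add: carrier_matD[OF shift_carrier] carrier_matD[OF carrier] lap_shift_def T_mat_def)
  then show ?thesis by (simp add: nontrivial_eigenvalues_shift)
qed

lemma sum_list_reciprocal_pos:
  fixes xs :: "real list"
  assumes "xs \<noteq> []" "\<forall>r\<in>set xs. 0 < r"
  shows "0 < (\<Sum>r\<leftarrow>xs. 1 / r)"
  using assms by (induction xs rule: list_nonempty_induct) (auto intro: add_pos_pos)

theorem corollary4p5:
  fixes \<alpha> m v b k :: nat
    and P :: "nat set set"
    and L :: "real mat"
  assumes "\<alpha> \<ge> 1" and "m \<ge> 2" and "b \<ge> 1" and "2 \<le> k" and "k < v"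
    and "v = \<alpha> * m" and "v dvd b * k"
    and "partition_on {..<v} P" and "card P = m" and "\<forall>A\<in>P. card A = \<alpha>"
    and "L = graph_laplacian v (multipartite_adj P)"
  shows "\<exists>x\<^sub>0::real. x\<^sub>0 > 0 \<and> (\<forall>x\<ge>x\<^sub>0.
           L \<in> laplacians2 v b k \<longrightarrow> is_design_laplacian v k (lap_shift v b k L x) \<longrightarrow>
           (\<forall>L'\<in>laplacians2 v b k. is_design_laplacian v k (lap_shift v b k L' x) \<longrightarrow>
              A_value (lap_shift v b k L' x) \<le> A_value (lap_shift v b k L x) \<and>
              D_value (lap_shift v b k L' x) \<le> D_value (lap_shift v b k L x)))"
proof (intro exI conjI allI impI ballI)
  let ?l = "real (rgd_lambda v b k)"
  \<comment> \<open>The added 1 makes the bound positive even for \<lambda> = 0 and forces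
    \<open>x\<close> above \<lambda>, so that \<open>y\<close> is positive.\<close>
  show "0 < ?l + 1" by simp
  fix x L'
  assume x: "?l + 1 \<le> x" and L: "L \<in> laplacians2 v b k" and L': "L' \<in> laplacians2 v b k"
  have v: "0 < v" using assms by simp
  define y where "y = real v * (x - ?l)"
  have y: "0 < y" using x v by (simp add: y_def)
  have lap: "L \<in> laplacians v b k" "L' \<in> laplacians v b k"
    using L L' by (auto simp: laplacians2_def)
  interpret L: zero_sum_symmetric L v using lap(1) v by (rule laplacian_zero_sum_symmetric)
  interpret L': zero_sum_symmetric L' v using lap(2) v by (rule laplacian_zero_sum_symmetric)
  define xs where "xs = nontrivial_eigenvalues L"
  define ys where "ys = nontrivial_eigenvalues L'"
  \<comment> \<open>Both matrices maximize over the same class, so each value bounds the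
    other.\<close>
  have elem_sym_eq: "elem_sym j xs = elem_sym j ys" if "j \<in> {1, 2}" for j
    unfolding xs_def ys_def using L L' that by (intro antisym) (auto simp: laplacians2_def)
  have len: "length xs = length ys" by (simp add: xs_def ys_def L.length_spec L'.length_spec)
  have s1: "sum_list xs = sum_list ys" using elem_sym_eq[of 1] by (simp add: elem_sym_1[unfolded One_nat_def])
  have s2: "(\<Sum>r\<leftarrow>xs. r\<^sup>2) = (\<Sum>r\<leftarrow>ys. r\<^sup>2)"
    using elem_sym_eq[of 2] elem_sym_2[of xs] elem_sym_2[of ys] s1 by simp
  have \<alpha>: "real \<alpha> \<le> real v" using assms by simp
  have xs: "set xs \<subseteq> {real v - real \<alpha>, real v}"
    unfolding xs_def using multipartite_spec assms L.zero_sum_symmetric_axioms by blast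
  note tr = multipartite_traces[OF assms(8,10,11) L.zero_sum_symmetric_axioms]
  have ys: "set ys \<subseteq> {0..real v}"
    unfolding ys_def
  \<comment> \<open>The equal power sums transfer the two traces of \<open>L\<close> to
    \<open>L'\<close>, with \<open>d = v - \<alpha>\<close>.\<close>
  proof (rule L'.spec_bounds, rule L'.off_diagonal_01[OF laplacian_off_diagonal[OF lap(2)]])
    show "(\<Sum>i<v. L' $$ (i, i)) = real v * (real v - real \<alpha>)"
      using tr(1) s1 by (simp add: xs_def ys_def L.sum_spec L'.sum_spec)
    show "(\<Sum>i<v. \<Sum>j<v. (L' $$ (i, j))\<^sup>2) = real v * ((real v - real \<alpha>)\<^sup>2 + (real v - real \<alpha>))"
      using tr(2) s2 by (simp add: xs_def ys_def L.sum_squares_spec L'.sum_squares_spec)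
  qed
  have shifted: "nontrivial_eigenvalues (lap_shift v b k L x) = map ((+) y) xs"
    "nontrivial_eigenvalues (lap_shift v b k L' x) = map ((+) y) ys"
    unfolding xs_def ys_def y_def
    by (rule L.nontrivial_eigenvalues_lap_shift, rule L'.nontrivial_eigenvalues_lap_shift)
  have c: "0 \<le> real v - real \<alpha>" "0 \<le> real v" using \<alpha> by auto
  show "D_value (lap_shift v b k L' x) \<le> D_value (lap_shift v b k L x)"
    unfolding D_value_def shifted by (rule prod_shift_le[OF len s1 s2 xs ys c y])
  have pos: "\<forall>r\<in>set (map ((+) y) xs). 0 < r" "\<forall>r\<in>set (map ((+) y) ys). 0 < r"
    using xs ys c y by (auto simp: add_pos_nonneg)
  have le: "(\<Sum>r\<leftarrow>map ((+) y) xs. 1 / r) \<le> (\<Sum>r\<leftarrow>map ((+) y) ys. 1 / r)"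
    using sum_reciprocal_le[OF len s1 s2 xs ys c y] by (simp add: o_def)
  have "length xs > 0" unfolding xs_def L.length_spec using assms(4,5) by simp
  then have "0 < (\<Sum>r\<leftarrow>map ((+) y) xs. 1 / r)"
    by (intro sum_list_reciprocal_pos pos) auto
  then have "real (length ys) / (\<Sum>r\<leftarrow>map ((+) y) ys. 1 / r) \<le> real (length xs) / (\<Sum>r\<leftarrow>map ((+) y) xs. 1 / r)"
    using le len by (intro frac_le) auto
  \<comment> \<open>No shifted eigenvalue is 0, so the default value in \<open>A_value\<close> does
    not occur.\<close>
  moreover have "0 \<notin> set (map ((+) y) xs)" "0 \<notin> set (map ((+) y) ys)" using pos by blast+
  ultimately show "A_value (lap_shift v b k L' x) \<le> A_value (lap_shift v b k L x)"
    unfolding A_value_def shifted Let_def by (simp only: if_False length_map)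
qed

end
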